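(* Let $n\ge 1$ be an integer, let $G=\mathrm{PAH}_n$, and let $a$ and $s$ be real numbers. Then (1) $\prod_{uv\in E(G)}(d(u)+d(v))^a = 4^{6an}\times 6^{(9n^2-3n)a}$; (2) $\prod_{uv\in E(G)}(d(u)d(v))^a = 3^{18an^2}$; (3) $\prod_{u\in V(G)} d(u)^s = 3^{6sn^2}$.
   Context: For a graph $G$, $d(v)$ denotes the degree of vertex $v$. The family $\mathrm{PAH}_n$ of graphs is defined recursively. $\mathrm{PAH}_1$ is the 6-cycle with one pendant vertex (leaf) attached to each of its six vertices (the graph of benzene). For $n\ge 1$, $\mathrm{PAH}_{n+1}$ is obtained from $\mathrm{PAH}_n$ by deleting all its leaves, then gluing a hexagon (6-cycle) onto each exterior edge (so that the hexagons form the next concentric hexagonal layer of the hexagonal lattice around the existing hexagonal system), and finally attaching one leaf to each exterior vertex of degree 2. Thus $\mathrm{PAH}_n$ consists of a hexagonal-shaped piece of the hexagonal lattice with $n$ hexagons on each side, every vertex of degree 2 of which receives a pendant leaf. *)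

theory Defs
  imports Complex_Main
begin

text \<open>
  Simple undirected graphs; an edge joining \<open>u\<close> and \<open>v\<close> is the two-element set \<open>{u, v}\<close>.
\<close>

record 'a ugraph =
  verts :: "'a set"
  edges :: "'a set set"

definition deg :: "'a ugraph \<Rightarrow> 'a \<Rightarrow> nat" where
  "deg G v = card {e \<in> edges G. v \<in> e}"

definition cycle_graph :: "'a list \<Rightarrow> 'a ugraph" where
  "cycle_graph xs = \<lparr>verts = set xs,
     edges = (\<lambda>(u, v). {u, v}) ` set (zip xs (rotate1 xs))\<rparr>"

definition delete_leaves :: "'a ugraph \<Rightarrow> 'a ugraph" where
  "delete_leaves G = \<lparr>verts = {v \<in> verts G. deg G v \<noteq> 1},
     edges = {e \<in> edges G. \<forall>v\<in>e. deg G v \<noteq> 1}\<rparr>"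

text \<open>
  The hexagons of the hexagonal lattice are indexed by their centres \<open>(i, j)\<close>, the points of the
  triangular lattice written in a basis of two unit vectors at an angle of 60 degrees.  The lattice
  vertices are the triangles of the triangular lattice: \<open>Up i j\<close> is the common corner of the
  hexagons \<open>(i, j)\<close>, \<open>(i + 1, j)\<close>, \<open>(i, j + 1)\<close>, and \<open>Down i j\<close> is that of \<open>(i + 1, j)\<close>,
  \<open>(i, j + 1)\<close>, \<open>(i + 1, j + 1)\<close>.  The pendant vertex attached to \<open>v\<close> is \<open>Leaf v\<close>; it is not a
  vertex of the lattice.
\<close>

datatype vertex = Up int int | Down int int | Leaf vertex

definition attach_leaves :: "vertex set \<Rightarrow> vertex ugraph \<Rightarrow> vertex ugraph" where
  "attach_leaves S G = \<lparr>verts = verts G \<union> Leaf ` S,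
     edges = edges G \<union> (\<lambda>v. {v, Leaf v}) ` S\<rparr>"

text \<open>The six corners are listed counterclockwise.\<close>

fun hexagon :: "int \<times> int \<Rightarrow> vertex ugraph" where
  "hexagon (i, j) = cycle_graph
     [Up i j, Down (i - 1) j, Up (i - 1) j, Down (i - 1) (j - 1), Up i (j - 1), Down i (j - 1)]"

text \<open>
  Every edge of the lattice lies on exactly two lattice hexagons; it is exterior for a hexagonal
  system \<open>G\<close> (a hole-free union of lattice hexagons) iff just one of them belongs to \<open>G\<close>.
\<close>

definition exterior_edges :: "vertex ugraph \<Rightarrow> vertex set set" where
  "exterior_edges G =
     {e \<in> edges G. \<exists>!h. e \<in> edges (hexagon h) \<and> edges (hexagon h) \<subseteq> edges G}"

definition exterior_vertices :: "vertex ugraph \<Rightarrow> vertex set" where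
  "exterior_vertices G = \<Union> (exterior_edges G)"

text \<open>
  For an exterior edge, one of the two lattice hexagons containing it is already present, so the
  union below adds precisely the hexagon on its outer side.
\<close>

definition glue_hexagons :: "vertex ugraph \<Rightarrow> vertex ugraph" where
  "glue_hexagons G =
     (let H = {h. edges (hexagon h) \<inter> exterior_edges G \<noteq> {}}
      in \<lparr>verts = verts G \<union> (\<Union>h\<in>H. verts (hexagon h)),
          edges = edges G \<union> (\<Union>h\<in>H. edges (hexagon h))\<rparr>)"

definition PAH_step :: "vertex ugraph \<Rightarrow> vertex ugraph" where
  "PAH_step G = (let G' = glue_hexagons (delete_leaves G)
     in attach_leaves {v \<in> exterior_vertices G'. deg G' v = 2} G')"

definition benzene :: "vertex ugraph" where
  "benzene = attach_leaves (verts (hexagon (0, 0))) (hexagon (0, 0))"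

text \<open>The family starts at \<open>n = 1\<close>; the value at \<open>0\<close> is a dummy.\<close>

definition PAH :: "nat \<Rightarrow> vertex ugraph" where
  "PAH n = (PAH_step ^^ (n - 1)) benzene"

lemma PAH_1: "PAH 1 = benzene"
  by (simp add: PAH_def)

lemma PAH_Suc: "n \<ge> 1 \<Longrightarrow> PAH (Suc n) = PAH_step (PAH n)"
  by (cases n) (auto simp: PAH_def)

lemma hexagon_edges:
  "edges (hexagon (i, j)) =
     {{Up i j, Down (i - 1) j}, {Down (i - 1) j, Up (i - 1) j},
      {Up (i - 1) j, Down (i - 1) (j - 1)}, {Down (i - 1) (j - 1), Up i (j - 1)},
      {Up i (j - 1), Down i (j - 1)}, {Down i (j - 1), Up i j}}"
  by (simp add: cycle_graph_def)

lemma hexagon_edge_card: "e \<in> edges (hexagon h) \<Longrightarrow> card e = 2"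
  by (cases h) (auto simp: hexagon_edges simp del: hexagon.simps)

lemma attach_leaves_edge_card:
  assumes "\<And>e. e \<in> edges G \<Longrightarrow> card e = 2" and "e \<in> edges (attach_leaves S G)"
  shows "card e = 2"
proof -
  have "v \<noteq> Leaf v" for v by (induction v) auto
  then show ?thesis using assms by (auto simp: attach_leaves_def)
qed

lemma PAH_step_edge_card:
  assumes "\<And>e. e \<in> edges G \<Longrightarrow> card e = 2" and "e \<in> edges (PAH_step G)"
  shows "card e = 2"
proof -
  have "card e = 2" if "e \<in> edges (glue_hexagons (delete_leaves G))" for e
    using that assms(1) hexagon_edge_card
    by (auto simp: glue_hexagons_def delete_leaves_def Let_def simp del: hexagon.simps)
  from attach_leaves_edge_card[OF this] assms(2) show ?thesis
    unfolding PAH_step_def Let_def by blast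
qed

lemma PAH_edge_card: "e \<in> edges (PAH n) \<Longrightarrow> card e = 2"
proof -
  have "e \<in> edges ((PAH_step ^^ m) benzene) \<Longrightarrow> card e = 2" for m e
  proof (induction m arbitrary: e)
    case 0
    then show ?case
      using attach_leaves_edge_card[of "hexagon (0, 0)"] hexagon_edge_card
      unfolding benzene_def funpow_0 by blast
  next
    case (Suc m)
    then show ?case
      using PAH_step_edge_card[of "(PAH_step ^^ m) benzene"] by simp
  qed
  then show "e \<in> edges (PAH n) \<Longrightarrow> card e = 2" by (simp add: PAH_def)
qed

end

theory Submission imports Defs begin

text \<open>
  Deleting the leaves of \<open>PAH n\<close> leaves the union of the lattice hexagons whose centres have
  hexagonal norm less than \<open>n\<close>, and gluing a hexagon onto every exterior edge turns this into the
  same union for \<open>n + 1\<close>.  Its vertices have degree 2 or 3, so in \<open>PAH n\<close> every lattice vertex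
  has degree 3 and every leaf degree 1.  The products therefore only depend on the number
  \<open>6n\<^sup>2\<close> of lattice vertices and the number \<open>6n\<close> of leaves; the number \<open>9n\<^sup>2 - 3n\<close> of lattice
  edges follows from the handshake lemma.
\<close>

section \<open>Hexagonal pieces of the lattice\<close>

declare hexagon.simps [simp del]

text \<open>In a basis of two unit vectors at 60 degrees the six shortest lattice vectors are (1,
  0), (0, 1), (1, -1) and their negatives, so max(|i|, |j|, |i + j|) is the distance from the origin
  in the triangular lattice.\<close>

definition hex_ball :: "int \<Rightarrow> (int \<times> int) set" where
  "hex_ball n = {(i, j). \<bar>i\<bar> < n \<and> \<bar>j\<bar> < n \<and> \<bar>i + j\<bar> < n}"

definition honeycomb :: "int \<Rightarrow> vertex ugraph" where
  "honeycomb n = \<lparr>verts = (\<Union>h\<in>hex_ball n. verts (hexagon h)),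
     edges = (\<Union>h\<in>hex_ball n. edges (hexagon h))\<rparr>"

definition boundary :: "int \<Rightarrow> vertex set" where
  "boundary n = {v \<in> verts (honeycomb n). deg (honeycomb n) v = 2}"

section \<open>Incidence of corners, edges and hexagons\<close>

lemma hexagon_verts:
  "verts (hexagon (i, j)) =
     {Up i j, Down (i - 1) j, Up (i - 1) j, Down (i - 1) (j - 1), Up i (j - 1), Down i (j - 1)}"
  by (simp add: hexagon.simps cycle_graph_def)

lemma Up_in_hexagon:
  "Up i j \<in> verts (hexagon h) \<longleftrightarrow> h \<in> {(i, j), (i + 1, j), (i, j + 1)}"
  by (cases h) (auto simp: hexagon_verts)

lemma Down_in_hexagon:
  "Down i j \<in> verts (hexagon h) \<longleftrightarrow> h \<in> {(i + 1, j), (i, j + 1), (i + 1, j + 1)}"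
  by (cases h) (auto simp: hexagon_verts)

lemma Leaf_notin_hexagon: "Leaf v \<notin> verts (hexagon h)"
  by (cases h) (auto simp: hexagon_verts)

text \<open>The lattice is bipartite, so an edge is given by its \<open>Up\<close> end and one of
  three directions. The two hexagons listed are those common to \<open>Up_in_hexagon\<close> and
  \<open>Down_in_hexagon\<close> for its ends.\<close>

lemma edge_in_hexagon:
  "{Up i j, Down i j} \<in> edges (hexagon h) \<longleftrightarrow> h \<in> {(i + 1, j), (i, j + 1)}"
  "{Up i j, Down (i - 1) j} \<in> edges (hexagon h) \<longleftrightarrow> h \<in> {(i, j), (i, j + 1)}"
  "{Up i j, Down i (j - 1)} \<in> edges (hexagon h) \<longleftrightarrow> h \<in> {(i, j), (i + 1, j)}"
  by (cases h; auto simp: hexagon_edges doubleton_eq_iff)+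

lemma hexagon_edgeE:
  assumes "e \<in> edges (hexagon h)"
  obtains i j where "e = {Up i j, Down i j}"
  | i j where "e = {Up i j, Down (i - 1) j}"
  | i j where "e = {Up i j, Down i (j - 1)}"
proof -
  obtain i j where h: "h = (i, j)" by (cases h)
  have "e = {Up i j, Down (i - 1) j} \<or> e = {Up (i - 1) j, Down (i - 1) j} \<or>
      e = {Up (i - 1) j, Down (i - 1) (j - 1)} \<or> e = {Up i (j - 1), Down (i - 1) (j - 1)} \<or>
      e = {Up i (j - 1), Down i (j - 1)} \<or> e = {Up i j, Down i (j - 1)}"
    using assms by (auto simp: h hexagon_edges)
  then show thesis using that by blast
qed

text \<open>As centroids of triangles, \<open>Up i j\<close> lies at (i + 1/3, j + 1/3) and
  \<open>Down i j\<close> at (i + 2/3, j + 2/3). The conditions say that max(|x|, |y|, |x + y|) < n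
  at this point (x, y); the fractional parts turn the open intervals into half-open integer
  ones.\<close>

lemma honeycomb_verts:
  "Up i j \<in> verts (honeycomb n) \<longleftrightarrow> {i, j, i + j} \<subseteq> {-n..<n}"
  "Down i j \<in> verts (honeycomb n) \<longleftrightarrow> {i, j, i + j + 1} \<subseteq> {-n..<n}"
  "Leaf v \<notin> verts (honeycomb n)"
proof -
  have "Up i j \<in> verts (honeycomb n) \<longleftrightarrow>
      (i, j) \<in> hex_ball n \<or> (i + 1, j) \<in> hex_ball n \<or> (i, j + 1) \<in> hex_ball n"
    unfolding honeycomb_def by (auto simp: Up_in_hexagon)
  also have "\<dots> \<longleftrightarrow> {i, j, i + j} \<subseteq> {-n..<n}"
    unfolding hex_ball_def mem_Collect_eq case_prod_conv insert_subset atLeastLessThan_iff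
    using empty_subsetI[of "{-n..<n}"] by (smt (verit))
  finally show "Up i j \<in> verts (honeycomb n) \<longleftrightarrow> {i, j, i + j} \<subseteq> {-n..<n}" .
  have "Down i j \<in> verts (honeycomb n) \<longleftrightarrow>
      (i + 1, j) \<in> hex_ball n \<or> (i, j + 1) \<in> hex_ball n \<or> (i + 1, j + 1) \<in> hex_ball n"
    unfolding honeycomb_def by (auto simp: Down_in_hexagon)
  also have "\<dots> \<longleftrightarrow> {i, j, i + j + 1} \<subseteq> {-n..<n}"
    unfolding hex_ball_def mem_Collect_eq case_prod_conv insert_subset atLeastLessThan_iff
    using empty_subsetI[of "{-n..<n}"] by (smt (verit))
  finally show "Down i j \<in> verts (honeycomb n) \<longleftrightarrow> {i, j, i + j + 1} \<subseteq> {-n..<n}" .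
  show "Leaf v \<notin> verts (honeycomb n)"
    by (simp add: honeycomb_def Leaf_notin_hexagon)
qed

text \<open>The honeycomb is an induced subgraph of the lattice, and passing from the
  \<open>Up\<close> end to the \<open>Down\<close> end can break only one bound, which is the
  inequality on the right.\<close>

lemma honeycomb_edges:
  "{Up i j, Down i j} \<in> edges (honeycomb n) \<longleftrightarrow>
     Up i j \<in> verts (honeycomb n) \<and> i + j + 1 < n" (is ?diagonal)
  "{Up i j, Down (i - 1) j} \<in> edges (honeycomb n) \<longleftrightarrow>
     Up i j \<in> verts (honeycomb n) \<and> - n < i" (is ?left)
  "{Up i j, Down i (j - 1)} \<in> edges (honeycomb n) \<longleftrightarrow>
     Up i j \<in> verts (honeycomb n) \<and> - n < j" (is ?right)
proof -
  have "{Up i j, Down i j} \<in> edges (honeycomb n) \<longleftrightarrow>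
      (i + 1, j) \<in> hex_ball n \<or> (i, j + 1) \<in> hex_ball n"
    unfolding honeycomb_def by (auto simp: edge_in_hexagon)
  then show ?diagonal
    unfolding honeycomb_verts hex_ball_def mem_Collect_eq case_prod_conv insert_subset
      atLeastLessThan_iff
    using empty_subsetI[of "{-n..<n}"] by (smt (verit))
  have "{Up i j, Down (i - 1) j} \<in> edges (honeycomb n) \<longleftrightarrow>
      (i, j) \<in> hex_ball n \<or> (i, j + 1) \<in> hex_ball n"
    unfolding honeycomb_def by (auto simp: edge_in_hexagon)
  then show ?left
    unfolding honeycomb_verts hex_ball_def mem_Collect_eq case_prod_conv insert_subset
      atLeastLessThan_iff
    using empty_subsetI[of "{-n..<n}"] by (smt (verit))
  have "{Up i j, Down i (j - 1)} \<in> edges (honeycomb n) \<longleftrightarrow>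
      (i, j) \<in> hex_ball n \<or> (i + 1, j) \<in> hex_ball n"
    unfolding honeycomb_def by (auto simp: edge_in_hexagon)
  then show ?right
    unfolding honeycomb_verts hex_ball_def mem_Collect_eq case_prod_conv insert_subset
      atLeastLessThan_iff
    using empty_subsetI[of "{-n..<n}"] by (smt (verit))
qed

lemma honeycomb_edgeE:
  assumes "e \<in> edges (honeycomb n)"
  obtains i j where "e = {Up i j, Down i j}"
  | i j where "e = {Up i j, Down (i - 1) j}"
  | i j where "e = {Up i j, Down i (j - 1)}"
  using assms by (auto simp: honeycomb_def elim: hexagon_edgeE)

text \<open>A hexagon outside the ball is never completed by edges of its neighbours: the presence
  of its edges forces the bounds on i, j and i + j that define the ball. Hence the subgraph test in
  \<open>exterior_edges\<close> becomes membership in the ball.\<close>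

lemma hexagon_subset_honeycomb:
  "edges (hexagon h) \<subseteq> edges (honeycomb n) \<longleftrightarrow> h \<in> hex_ball n"
proof
  obtain i j where h: "h = (i, j)" by (cases h)
  assume sub: "edges (hexagon h) \<subseteq> edges (honeycomb n)"
  have "{Up i j, Down (i - 1) j} \<in> edges (honeycomb n)"
    "{Up i j, Down i (j - 1)} \<in> edges (honeycomb n)"
    "{Up (i - 1) j, Down (i - 1) j} \<in> edges (honeycomb n)"
    "{Up (i - 1) j, Down (i - 1) (j - 1)} \<in> edges (honeycomb n)"
    "{Up i (j - 1), Down i (j - 1)} \<in> edges (honeycomb n)"
    by (rule subsetD[OF sub], simp add: h edge_in_hexagon hexagon_edges insert_commute)+
  then show "h \<in> hex_ball n"
    unfolding honeycomb_edges honeycomb_verts by (simp add: hex_ball_def h) linarith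
qed (auto simp: honeycomb_def)

section \<open>Exterior edges and the next layer of hexagons\<close>

lemma exterior_edges_honeycomb:
  "e \<in> exterior_edges (honeycomb n) \<longleftrightarrow> (\<exists>!h. e \<in> edges (hexagon h) \<and> h \<in> hex_ball n)"
  unfolding exterior_edges_def hexagon_subset_honeycomb by (auto simp: honeycomb_def)

lemma ex1_two:
  assumes "a \<noteq> b"
  shows "(\<exists>!h. h \<in> {a, b} \<and> P h) \<longleftrightarrow> P a \<noteq> P b"
  using assms by auto

lemma exterior_edge_iff:
  "{Up i j, Down i j} \<in> exterior_edges (honeycomb n) \<longleftrightarrow>
     ((i + 1, j) \<in> hex_ball n) \<noteq> ((i, j + 1) \<in> hex_ball n)"
  "{Up i j, Down (i - 1) j} \<in> exterior_edges (honeycomb n) \<longleftrightarrow>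
     ((i, j) \<in> hex_ball n) \<noteq> ((i, j + 1) \<in> hex_ball n)"
  "{Up i j, Down i (j - 1)} \<in> exterior_edges (honeycomb n) \<longleftrightarrow>
     ((i, j) \<in> hex_ball n) \<noteq> ((i + 1, j) \<in> hex_ball n)"
  unfolding exterior_edges_honeycomb edge_in_hexagon
  by (rule ex1_two; simp)+

text \<open>Hexagons sharing an edge have adjacent centres, so gluing raises the norm by at most 1;
  conversely every centre of norm n has a neighbour of norm n - 1. The union with the ball is taken
  because the glued set also contains the inner hexagons along the border.\<close>

lemma glued_hexagons:
  assumes "n \<ge> 1"
  shows "hex_ball n \<union> {h. edges (hexagon h) \<inter> exterior_edges (honeycomb n) \<noteq> {}}
           = hex_ball (n + 1)" (is "_ \<union> ?H = _")
proof (intro subset_antisym subsetI)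
  fix h assume "h \<in> hex_ball n \<union> ?H"
  then consider "h \<in> hex_ball n" | e where "e \<in> edges (hexagon h)" "e \<in> exterior_edges (honeycomb n)"
    by auto
  note cases = this
  \<comment> \<open>Adjacent centres differ by at most 1 in each of i, j and i + j.\<close>
  have near: "(i', j') \<in> hex_ball (n + 1)"
    if "(i, j) \<in> hex_ball n" "\<bar>i - i'\<bar> \<le> 1" "\<bar>j - j'\<bar> \<le> 1" "\<bar>i + j - (i' + j')\<bar> \<le> 1" for i j i' j'
    using that unfolding hex_ball_def mem_Collect_eq case_prod_conv by (smt (verit))
  from cases show "h \<in> hex_ball (n + 1)"
  proof cases
    case 1
    then show ?thesis by (auto simp: hex_ball_def)
  next
    case 2
    from 2(1) show ?thesis
    proof (cases rule: hexagon_edgeE)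
      case (1 k l)
      with 2 have "h \<in> {(k + 1, l), (k, l + 1)}" "(k + 1, l) \<in> hex_ball n \<or> (k, l + 1) \<in> hex_ball n"
        by (auto simp: exterior_edge_iff edge_in_hexagon)
      then show ?thesis by (auto elim: near)
    next
      case (2 k l)
      with \<open>e \<in> edges (hexagon h)\<close> \<open>e \<in> exterior_edges _\<close>
      have "h \<in> {(k, l), (k, l + 1)}" "(k, l) \<in> hex_ball n \<or> (k, l + 1) \<in> hex_ball n"
        by (auto simp: exterior_edge_iff edge_in_hexagon)
      then show ?thesis by (auto elim: near)
    next
      case (3 k l)
      with 2 have "h \<in> {(k, l), (k + 1, l)}" "(k, l) \<in> hex_ball n \<or> (k + 1, l) \<in> hex_ball n"
        by (auto simp: exterior_edge_iff edge_in_hexagon)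
      then show ?thesis by (auto elim: near)
    qed
  qed
next
  fix h assume *: "h \<in> hex_ball (n + 1)"
  obtain i j where h: "h = (i, j)" by (cases h)
  show "h \<in> hex_ball n \<union> ?H"
  proof (cases "h \<in> hex_ball n")
    case False
    \<comment> \<open>Here the norm of h is exactly n, and since n \<ge> 1 one of the six unit steps
      leads closer to the origin.\<close>
    have neighbour: "(i - 1, j) \<in> hex_ball n \<or> (i + 1, j) \<in> hex_ball n \<or> (i, j - 1) \<in> hex_ball n \<or>
      (i, j + 1) \<in> hex_ball n \<or> (i - 1, j + 1) \<in> hex_ball n \<or> (i + 1, j - 1) \<in> hex_ball n"
      using * False assms unfolding h hex_ball_def mem_Collect_eq case_prod_conv by (smt (verit))
    \<comment> \<open>The six edges of h separate it from its six neighbours; the one towards a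
      neighbour in the ball is exterior.\<close>
    have "{Up (i - 1) j, Down (i - 1) j} \<in> exterior_edges (honeycomb n) \<or>
      {Up i (j - 1), Down i (j - 1)} \<in> exterior_edges (honeycomb n) \<or>
      {Up i j, Down (i - 1) j} \<in> exterior_edges (honeycomb n) \<or>
      {Up i (j - 1), Down (i - 1) (j - 1)} \<in> exterior_edges (honeycomb n) \<or>
      {Up i j, Down i (j - 1)} \<in> exterior_edges (honeycomb n) \<or>
      {Up (i - 1) j, Down (i - 1) (j - 1)} \<in> exterior_edges (honeycomb n)"
      using neighbour False unfolding exterior_edge_iff h by auto
    then have "h \<in> ?H"
      unfolding h using edge_in_hexagon by (auto simp: hexagon_edges insert_commute)
    then show ?thesis ..
  qed simp
qed

lemma glue_honeycomb:
  assumes "n \<ge> 1"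
  shows "glue_hexagons (honeycomb n) = honeycomb (n + 1)"
  unfolding glue_hexagons_def Let_def honeycomb_def[of "n + 1"] glued_hexagons[OF assms, symmetric]
  by (simp add: honeycomb_def)

section \<open>Degrees in the honeycomb\<close>

lemma deg_eq_card_neighbours:
  assumes "\<And>e. e \<in> edges G \<Longrightarrow> v \<in> e \<Longrightarrow> \<exists>w. e = {v, w}"
  shows "deg G v = card {w. {v, w} \<in> edges G}"
proof -
  have "{e \<in> edges G. v \<in> e} = (\<lambda>w. {v, w}) ` {w. {v, w} \<in> edges G}"
    using assms by blast
  then show ?thesis
    unfolding deg_def by (simp add: card_image inj_on_def doubleton_eq_iff)
qed

lemma deg_honeycomb:
  "deg (honeycomb n) v = card {w. {v, w} \<in> edges (honeycomb n)}"
  by (rule deg_eq_card_neighbours) (auto elim!: honeycomb_edgeE)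

lemma Up_neighbours:
  "{w. {Up i j, w} \<in> edges (honeycomb n)} =
     {w \<in> {Down i j, Down (i - 1) j, Down i (j - 1)}. {Up i j, w} \<in> edges (honeycomb n)}"
proof -
  have "w \<in> {Down i j, Down (i - 1) j, Down i (j - 1)}"
    if "{Up i j, w} \<in> edges (honeycomb n)" for w
    using that by (cases rule: honeycomb_edgeE) (auto simp: doubleton_eq_iff)
  then show ?thesis by blast
qed

lemma Down_neighbours:
  "{w. {Down i j, w} \<in> edges (honeycomb n)} =
     {w \<in> {Up i j, Up (i + 1) j, Up i (j + 1)}. {w, Down i j} \<in> edges (honeycomb n)}"
proof -
  have "w \<in> {Up i j, Up (i + 1) j, Up i (j + 1)}"
    if "{Down i j, w} \<in> edges (honeycomb n)" for w
    using that by (cases rule: honeycomb_edgeE) (auto simp: doubleton_eq_iff)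
  then show ?thesis by (auto simp: insert_commute)
qed

lemma honeycomb_edges_Down:
  "{Up i j, Down i j} \<in> edges (honeycomb n) \<longleftrightarrow>
     Down i j \<in> verts (honeycomb n) \<and> - n \<le> i + j"
  "{Up (i + 1) j, Down i j} \<in> edges (honeycomb n) \<longleftrightarrow>
     Down i j \<in> verts (honeycomb n) \<and> i + 1 < n"
  "{Up i (j + 1), Down i j} \<in> edges (honeycomb n) \<longleftrightarrow>
     Down i j \<in> verts (honeycomb n) \<and> j + 1 < n"
  using honeycomb_edges(1)[of i j n] honeycomb_edges(2)[of "i + 1" j n]
    honeycomb_edges(3)[of i "j + 1" n]
  unfolding honeycomb_verts insert_subset atLeastLessThan_iff add_diff_cancel_right'
  using empty_subsetI[of "{-n..<n}"] by (smt (verit))+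

text \<open>Each of the three equalities removes one of the three lattice edges. For n \<ge> 1 no
  two hold together: i = j = -n violates -n \<le> i + j, and i = -n with i + j + 1 = n violates j <
  n, likewise with i and j exchanged.\<close>

lemma deg_honeycomb_Up:
  assumes "n \<ge> 1" "Up i j \<in> verts (honeycomb n)"
  shows "deg (honeycomb n) (Up i j) = (if i = - n \<or> j = - n \<or> i + j + 1 = n then 2 else 3)"
proof -
  have "deg (honeycomb n) (Up i j) =
    card ((if i + j + 1 < n then {Down i j} else {}) \<union> (if - n < i then {Down (i - 1) j} else {}) \<union>
      (if - n < j then {Down i (j - 1)} else {}))"
    unfolding deg_honeycomb Up_neighbours using assms(2)
    by (intro arg_cong[of _ _ card]) (auto simp: honeycomb_edges)
  then show ?thesis using assms by (auto simp: honeycomb_verts)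
qed

lemma deg_honeycomb_Down:
  assumes "n \<ge> 1" "Down i j \<in> verts (honeycomb n)"
  shows "deg (honeycomb n) (Down i j) = (if i + 1 = n \<or> j + 1 = n \<or> i + j + 1 = - n then 2 else 3)"
proof -
  have "deg (honeycomb n) (Down i j) =
    card ((if - n \<le> i + j then {Up i j} else {}) \<union> (if i + 1 < n then {Up (i + 1) j} else {}) \<union>
      (if j + 1 < n then {Up i (j + 1)} else {}))"
    unfolding deg_honeycomb Down_neighbours using assms(2)
    by (intro arg_cong[of _ _ card]) (auto simp: honeycomb_edges_Down)
  then show ?thesis using assms by (auto simp: honeycomb_verts)
qed

lemma boundary_iff:
  assumes "n \<ge> 1"
  shows "Up i j \<in> boundary n \<longleftrightarrow> Up i j \<in> verts (honeycomb n) \<and> (i = - n \<or> j = - n \<or> i + j + 1 = n)"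
    and "Down i j \<in> boundary n \<longleftrightarrow>
      Down i j \<in> verts (honeycomb n) \<and> (i + 1 = n \<or> j + 1 = n \<or> i + j + 1 = - n)"
    and "Leaf v \<notin> boundary n"
  using deg_honeycomb_Up[OF assms, of i j] deg_honeycomb_Down[OF assms, of i j]
  by (auto simp: boundary_def honeycomb_verts(3) split: if_splits)

lemma deg_honeycomb_vertex:
  assumes "n \<ge> 1" "v \<in> verts (honeycomb n)"
  shows "deg (honeycomb n) v = (if v \<in> boundary n then 2 else 3)"
  using assms by (cases v) (auto simp: deg_honeycomb_Up deg_honeycomb_Down boundary_iff honeycomb_verts(3))

section \<open>Vertices of degree 2 are exterior\<close>

lemma hexagon_edge_subset: "e \<in> edges (hexagon h) \<Longrightarrow> e \<subseteq> verts (hexagon h)"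
  by (cases h) (auto simp: hexagon_edges hexagon_verts)

lemma honeycomb_edge_subset:
  assumes "e \<in> edges (honeycomb n)"
  shows "e \<subseteq> verts (honeycomb n)"
proof -
  from assms obtain h where "h \<in> hex_ball n" "e \<in> edges (hexagon h)"
    by (auto simp: honeycomb_def)
  then show ?thesis using hexagon_edge_subset[of e h] by (auto simp: honeycomb_def)
qed

lemma exterior_vertices_subset: "exterior_vertices (honeycomb n) \<subseteq> verts (honeycomb n)"
  using honeycomb_edge_subset unfolding exterior_vertices_def exterior_edges_def by blast

text \<open>A missing edge rules out both hexagons on it, so a vertex of degree 2 lies on a single
  hexagon of the ball and both of its edges are exterior. Among any two of its three lattice edges
  at least one is present, so two candidates suffice.\<close>

lemma boundary_exterior:
  assumes "n \<ge> 1" "v \<in> boundary n"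
  shows "v \<in> exterior_vertices (honeycomb n)"
proof -
  have "\<exists>e \<in> exterior_edges (honeycomb n). v \<in> e"
  proof (cases v)
    case (Up i j)
    have "{Up i j, Down i j} \<in> exterior_edges (honeycomb n) \<or>
      {Up i j, Down (i - 1) j} \<in> exterior_edges (honeycomb n)"
      using assms unfolding Up boundary_iff[OF assms(1)] honeycomb_verts exterior_edge_iff
        hex_ball_def mem_Collect_eq case_prod_conv insert_subset atLeastLessThan_iff
      by (smt (verit))
    then show ?thesis by (auto simp: Up)
  next
    case (Down i j)
    \<comment> \<open>The form \<open>i + 1 - 1\<close> matches the second equivalence of
      \<open>exterior_edge_iff\<close>.\<close>
    have "{Up i j, Down i j} \<in> exterior_edges (honeycomb n) \<or>
      {Up (i + 1) j, Down (i + 1 - 1) j} \<in> exterior_edges (honeycomb n)"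
      using assms unfolding Down boundary_iff[OF assms(1)] honeycomb_verts exterior_edge_iff
        hex_ball_def mem_Collect_eq case_prod_conv insert_subset atLeastLessThan_iff
      by (smt (verit))
    then show ?thesis by (auto simp: Down)
  next
    case (Leaf w)
    then show ?thesis using assms boundary_iff(3) by auto
  qed
  then show ?thesis by (auto simp: exterior_vertices_def)
qed

lemma exterior_deg_2:
  assumes "n \<ge> 1"
  shows "{v \<in> exterior_vertices (honeycomb n). deg (honeycomb n) v = 2} = boundary n"
  using boundary_exterior[OF assms] exterior_vertices_subset[of n] by (auto simp: boundary_def)

lemma finite_hex_ball: "finite (hex_ball n)"
  by (rule finite_subset[of _ "{-n..n} \<times> {-n..n}"]) (auto simp: hex_ball_def)

lemma finite_honeycomb: "finite (verts (honeycomb n))" "finite (edges (honeycomb n))"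
proof -
  have "finite (verts (hexagon h))" "finite (edges (hexagon h))" for h
    by (cases h; simp add: hexagon_verts hexagon_edges)+
  then show "finite (verts (honeycomb n))" "finite (edges (honeycomb n))"
    by (simp_all add: honeycomb_def finite_hex_ball)
qed

lemma honeycomb_edge_card: "e \<in> edges (honeycomb n) \<Longrightarrow> card e = 2"
  using hexagon_edge_card by (auto simp: honeycomb_def)

section \<open>Leaves and the closed form of the family\<close>

lemma Leaf_neq [simp]: "v \<noteq> Leaf v" "Leaf v \<noteq> v"
  by (induction v) auto

lemma leaf_edge_notin_honeycomb: "{v, Leaf v} \<notin> edges (honeycomb n)"
  using honeycomb_edge_subset[of "{v, Leaf v}" n] honeycomb_verts(3) by blast

definition leafed_honeycomb :: "int \<Rightarrow> vertex ugraph" where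
  "leafed_honeycomb n = attach_leaves (boundary n) (honeycomb n)"

lemma boundary_subset: "boundary n \<subseteq> verts (honeycomb n)"
  by (auto simp: boundary_def)

lemma deg_leafed_honeycomb:
  assumes "n \<ge> 1" "v \<in> verts (honeycomb n)"
  shows "deg (leafed_honeycomb n) v = 3"
proof -
  let ?L = "if v \<in> boundary n then {{v, Leaf v}} else {}"
  have "v \<noteq> Leaf w" for w
    using assms(2) honeycomb_verts(3) by metis
  then have "{e \<in> edges (leafed_honeycomb n). v \<in> e} = {e \<in> edges (honeycomb n). v \<in> e} \<union> ?L"
    by (auto simp: leafed_honeycomb_def attach_leaves_def)
  moreover have "{e \<in> edges (honeycomb n). v \<in> e} \<inter> ?L = {}"
    by (auto simp: leaf_edge_notin_honeycomb)
  ultimately have "deg (leafed_honeycomb n) v = deg (honeycomb n) v + card ?L"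
    unfolding deg_def by (simp add: card_Un_disjoint finite_honeycomb(2))
  then show ?thesis
    using assms by (simp add: deg_honeycomb_vertex)
qed

lemma deg_leafed_honeycomb_Leaf:
  assumes "v \<in> boundary n"
  shows "deg (leafed_honeycomb n) (Leaf v) = 1"
proof -
  have "Leaf v \<notin> e" if "e \<in> edges (honeycomb n)" for e
    using that honeycomb_edge_subset honeycomb_verts(3) by blast
  moreover have "Leaf v \<notin> boundary n"
    using boundary_subset honeycomb_verts(3) by blast
  ultimately have "{e \<in> edges (leafed_honeycomb n). Leaf v \<in> e} = {{v, Leaf v}}"
    using assms by (auto simp: leafed_honeycomb_def attach_leaves_def)
  then show ?thesis by (simp add: deg_def)
qed

text \<open>Lattice vertices have degree 3 and leaves degree 1, so the degree test removes exactly
  the leaves, and with them exactly the pendant edges.\<close>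

lemma delete_leaves_leafed_honeycomb:
  assumes "n \<ge> 1"
  shows "delete_leaves (leafed_honeycomb n) = honeycomb n"
proof -
  let ?G = "leafed_honeycomb n"
  have "{v \<in> verts ?G. deg ?G v \<noteq> 1} = verts (honeycomb n)"
    using deg_leafed_honeycomb[OF assms] deg_leafed_honeycomb_Leaf
    by (auto simp: leafed_honeycomb_def attach_leaves_def)
  moreover have "{e \<in> edges ?G. \<forall>v\<in>e. deg ?G v \<noteq> 1} = edges (honeycomb n)"
  proof (intro subset_antisym subsetI)
    fix e assume "e \<in> {e \<in> edges ?G. \<forall>v\<in>e. deg ?G v \<noteq> 1}"
    then show "e \<in> edges (honeycomb n)"
      using deg_leafed_honeycomb_Leaf by (auto simp: leafed_honeycomb_def attach_leaves_def)
  next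
    fix e assume e: "e \<in> edges (honeycomb n)"
    then have "\<forall>v\<in>e. deg ?G v = 3"
      using deg_leafed_honeycomb[OF assms] honeycomb_edge_subset by blast
    with e show "e \<in> {e \<in> edges ?G. \<forall>v\<in>e. deg ?G v \<noteq> 1}"
      by (simp add: leafed_honeycomb_def attach_leaves_def)
  qed
  ultimately show ?thesis by (simp add: delete_leaves_def)
qed

text \<open>The ball of radius 1 holds only the central hexagon, all of whose corners have degree 2,
  so leaves on all corners are leaves on the boundary.\<close>

lemma benzene_eq: "benzene = leafed_honeycomb 1"
proof -
  have "hex_ball 1 = {(0, 0)}" by (auto simp: hex_ball_def)
  then have honeycomb_1: "honeycomb 1 = hexagon (0, 0)" by (simp add: honeycomb_def)
  have "v \<in> boundary 1" if "v \<in> verts (honeycomb 1)" for v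
    using that unfolding honeycomb_1 hexagon_verts
    by (auto simp: boundary_iff honeycomb_verts)
  then have "boundary 1 = verts (honeycomb 1)"
    using boundary_subset by blast
  then show ?thesis by (simp add: benzene_def leafed_honeycomb_def honeycomb_1)
qed

lemma PAH_eq:
  assumes "n \<ge> 1"
  shows "PAH n = leafed_honeycomb (int n)"
  using assms
proof (induction n rule: nat_induct_at_least)
  case base
  then show ?case using PAH_1 benzene_eq by simp
next
  case (Suc n)
  then have n: "int n \<ge> 1" "int n + 1 \<ge> 1" by simp_all
  have "PAH (Suc n) = PAH_step (leafed_honeycomb (int n))"
    using Suc by (simp add: PAH_Suc)
  also have "\<dots> = leafed_honeycomb (int n + 1)"
    unfolding PAH_step_def Let_def delete_leaves_leafed_honeycomb[OF n(1)] glue_honeycomb[OF n(1)]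
      exterior_deg_2[OF n(2)] by (simp add: leafed_honeycomb_def)
  finally show ?case by (simp add: add.commute)
qed

section \<open>Counting vertices and boundary vertices\<close>

definition up_cells :: "int \<Rightarrow> (int \<times> int) set" where
  "up_cells n = {(i, j). {i, j, i + j} \<subseteq> {-n..<n}}"

text \<open>
  The two triangles where \<open>i\<close> and \<open>j\<close> have the same sign fit together to a rhombus congruent to
  each of the two rhombi where they have opposite signs.
\<close>

lemma card_up_cells: "card (up_cells (int n)) = 3 * n\<^sup>2"
proof -
  let ?A = "{-int n..<0} \<times> {0..<int n}" and ?B = "{0..<int n} \<times> {-int n..<0}"
  let ?S = "{(i, j) \<in> {0..<int n} \<times> {0..<int n}. i + j < int n}"
  let ?T = "{(i, j) \<in> {-int n..<0} \<times> {-int n..<0}. i + j \<ge> - int n}"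
  let ?shift = "\<lambda>(i, j). (i + int n, j + int n)"
  have fin: "finite ?S" "finite ?T"
    by (rule finite_subset[of _ "{-int n..int n} \<times> {-int n..int n}"]; auto)+
  have "card ?S + card ?T = card ?S + card (?shift ` ?T)"
    by (simp add: card_image inj_on_def)
  also have "\<dots> = card (?S \<union> ?shift ` ?T)"
    using fin by (intro card_Un_disjoint[symmetric]) auto
  \<comment> \<open>The shift by (n, n) turns i + j \<ge> -n into i + j \<ge> n, which describes the
    complement of \<open>?S\<close> in the square.\<close>
  also have "?S \<union> ?shift ` ?T = {0..<int n} \<times> {0..<int n}"
  proof (intro subset_antisym subsetI)
    fix x assume x: "x \<in> {0..<int n} \<times> {0..<int n}"
    obtain i j where ij: "x = (i, j)" by (cases x)
    show "x \<in> ?S \<union> ?shift ` ?T"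
    proof (cases "i + j < int n")
      case False
      then have "(i - int n, j - int n) \<in> ?T" using x ij by auto
      then have "?shift (i - int n, j - int n) \<in> ?shift ` ?T" by (rule imageI)
      then show ?thesis using ij by simp
    qed (use x ij in auto)
  qed auto
  finally have triangles: "card ?S + card ?T = n\<^sup>2"
    by (simp add: power2_eq_square)
  have "card (up_cells (int n)) = card ((?A \<union> ?B) \<union> (?S \<union> ?T))"
    by (rule arg_cong[of _ _ card]) (auto simp: up_cells_def)
  moreover have "card ((?A \<union> ?B) \<union> (?S \<union> ?T)) = card (?A \<union> ?B) + card (?S \<union> ?T)"
    using fin by (intro card_Un_disjoint) auto
  moreover have "card (?S \<union> ?T) = card ?S + card ?T"
    by (rule card_Un_disjoint[OF fin]) auto
  moreover have "card (?A \<union> ?B) = card ?A + card ?B"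
    by (intro card_Un_disjoint) auto
  moreover have "card ?A = n\<^sup>2" "card ?B = n\<^sup>2"
    by (simp_all add: power2_eq_square)
  ultimately show ?thesis
    using triangles by linarith
qed

text \<open>Each equality cuts out a side with n points: on i = -n the bound -n \<le> i + j forces j
  \<ge> 0, symmetrically for j = -n, and on i + j = n - 1 the bound j < n forces i \<ge> 0. The
  signs of i and j keep the sides disjoint.\<close>

lemma card_up_cells_boundary:
  assumes "n \<ge> 1"
  shows "card {(i, j) \<in> up_cells (int n). i = - int n \<or> j = - int n \<or> i + j + 1 = int n} = 3 * n"
proof -
  let ?I = "{0..<int n}"
  let ?A = "Pair (- int n) ` ?I" and ?B = "(\<lambda>i. (i, - int n)) ` ?I"
    and ?C = "(\<lambda>i. (i, int n - 1 - i)) ` ?I"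
  have "card {(i, j) \<in> up_cells (int n). i = - int n \<or> j = - int n \<or> i + j + 1 = int n} =
      card (?A \<union> ?B \<union> ?C)"
    using assms by (intro arg_cong[of _ _ card]) (auto simp: up_cells_def image_iff)
  moreover have "card (?A \<union> ?B \<union> ?C) = card (?A \<union> ?B) + card ?C"
    using assms by (intro card_Un_disjoint) auto
  moreover have "card (?A \<union> ?B) = card ?A + card ?B"
    using assms by (intro card_Un_disjoint) auto
  moreover have "card ?A = n" "card ?B = n" "card ?C = n"
    by (simp_all add: card_image inj_on_def)
  ultimately show ?thesis by linarith
qed

text \<open>The second image is the reflection of the first in the centre of the hexagon \<open>(0, 0)\<close>.\<close>

definition up_down :: "(int \<times> int) set \<Rightarrow> vertex set" where
  "up_down X = (\<lambda>(i, j). Up i j) ` X \<union> (\<lambda>(i, j). Down (- 1 - i) (- 1 - j)) ` X"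

lemma card_up_down:
  assumes "finite X"
  shows "card (up_down X) = 2 * card X"
proof -
  have "card ((\<lambda>(i, j). Up i j) ` X) = card X"
    "card ((\<lambda>(i, j). Down (- 1 - i) (- 1 - j)) ` X) = card X"
    by (intro card_image; auto simp: inj_on_def)+
  then show ?thesis
    unfolding up_down_def using assms by (subst card_Un_disjoint) auto
qed

lemma mem_up_down:
  "Up i j \<in> up_down X \<longleftrightarrow> (i, j) \<in> X"
  "Down i j \<in> up_down X \<longleftrightarrow> (- 1 - i, - 1 - j) \<in> X"
  "Leaf v \<notin> up_down X"
  unfolding up_down_def by (force simp: image_iff)+

lemma finite_up_cells: "finite (up_cells n)"
  by (rule finite_subset[of _ "{-n..n} \<times> {-n..n}"]) (auto simp: up_cells_def)

text \<open>The map t to -1 - t preserves \<open>{-n..<n}\<close>, and it sends i + j + 1 to the sum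
  of the reflected coordinates.\<close>

lemma verts_honeycomb_up_down: "verts (honeycomb n) = up_down (up_cells n)"
proof (rule set_eqI)
  fix v show "v \<in> verts (honeycomb n) \<longleftrightarrow> v \<in> up_down (up_cells n)"
    by (cases v) (auto simp: mem_up_down honeycomb_verts up_cells_def)
qed

text \<open>The same map exchanges the extreme values -n and n - 1, hence the equalities for
  \<open>Down\<close> and \<open>Up\<close>.\<close>

lemma boundary_up_down:
  assumes "n \<ge> 1"
  shows "boundary n = up_down {(i, j) \<in> up_cells n. i = - n \<or> j = - n \<or> i + j + 1 = n}"
proof (rule set_eqI)
  fix v show "v \<in> boundary n \<longleftrightarrow>
      v \<in> up_down {(i, j) \<in> up_cells n. i = - n \<or> j = - n \<or> i + j + 1 = n}"
    using assms
    by (cases v) (auto simp: mem_up_down boundary_iff honeycomb_verts up_cells_def)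
qed

lemma card_verts_honeycomb: "card (verts (honeycomb (int n))) = 6 * n\<^sup>2"
  by (simp add: verts_honeycomb_up_down card_up_down finite_up_cells card_up_cells)

lemma card_boundary:
  assumes "n \<ge> 1"
  shows "card (boundary (int n)) = 6 * n"
proof -
  have "finite {(i, j) \<in> up_cells (int n). i = - int n \<or> j = - int n \<or> i + j + 1 = int n}"
    by (rule finite_subset[OF _ finite_up_cells[of "int n"]]) auto
  then show ?thesis
    using assms by (simp add: boundary_up_down card_up_down card_up_cells_boundary)
qed

section \<open>Edge counts and products over edges\<close>

lemma handshake:
  assumes "finite (verts G)" "finite (edges G)"
    and "\<And>e. e \<in> edges G \<Longrightarrow> e \<subseteq> verts G \<and> card e = 2"
  shows "(\<Sum>v\<in>verts G. deg G v) = 2 * card (edges G)"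
  unfolding deg_def
proof (rule sum_multicount[OF assms(1,2)], rule ballI)
  fix e assume "e \<in> edges G"
  then have "{v \<in> verts G. v \<in> e} = e" "card e = 2" using assms(3) by blast+
  then show "card {v \<in> verts G. v \<in> e} = 2" by simp
qed

text \<open>Adding 1 to the degree of each of the 6n boundary vertices makes all 6n^2 degrees equal
  to 3, so twice the number of edges plus 6n is 18n^2. The additive form avoids truncated
  subtraction.\<close>

lemma card_edges_honeycomb:
  assumes "n \<ge> 1"
  shows "card (edges (honeycomb (int n))) + 3 * n = 9 * n\<^sup>2"
proof -
  let ?V = "verts (honeycomb (int n))" and ?B = "boundary (int n)"
  have "2 * card (edges (honeycomb (int n))) + card ?B =
      (\<Sum>v\<in>?V. deg (honeycomb (int n)) v) + (\<Sum>v\<in>?V. if v \<in> ?B then 1 else 0)"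
    using handshake[of "honeycomb (int n)"] honeycomb_edge_subset honeycomb_edge_card
      boundary_subset[of "int n"]
    by (simp add: finite_honeycomb sum.If_cases Int_absorb1 Int_def[symmetric])
  also have "\<dots> = (\<Sum>v\<in>?V. 3)"
    unfolding sum.distrib[symmetric] using assms
    by (intro sum.cong) (auto simp: deg_honeycomb_vertex)
  finally show ?thesis
    using assms by (simp add: card_verts_honeycomb card_boundary)
qed

text \<open>Both edge products of the theorem have this shape: a factor depends only on whether the
  edge is a lattice edge or a pendant edge.\<close>

lemma prod_edges_leafed_honeycomb:
  fixes f :: "vertex set \<Rightarrow> 'a :: comm_monoid_mult"
  assumes n: "n \<ge> 1"
    and x: "\<And>e. e \<in> edges (honeycomb (int n)) \<Longrightarrow> f e = x"
    and y: "\<And>v. v \<in> boundary (int n) \<Longrightarrow> f {v, Leaf v} = y"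
  shows "prod f (edges (leafed_honeycomb (int n))) = x ^ (9 * n\<^sup>2 - 3 * n) * y ^ (6 * n)"
proof -
  let ?E = "edges (honeycomb (int n))" and ?L = "(\<lambda>v. {v, Leaf v}) ` boundary (int n)"
  have fin: "finite (boundary (int n))"
    using boundary_subset finite_honeycomb(1) by (rule finite_subset)
  have "inj_on (\<lambda>v. {v, Leaf v}) (boundary (int n))"
  proof (rule inj_onI)
    fix v w assume "v \<in> boundary (int n)" "w \<in> boundary (int n)" "{v, Leaf v} = {w, Leaf w}"
    then show "v = w" using boundary_subset honeycomb_verts(3) by (auto simp: doubleton_eq_iff)
  qed
  then have "prod f ?L = y ^ (6 * n)"
    using y n by (simp add: prod.reindex card_boundary)
  moreover have "prod f ?E = x ^ (9 * n\<^sup>2 - 3 * n)"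
    using x card_edges_honeycomb[OF n, symmetric] by simp
  moreover have "prod f (?E \<union> ?L) = prod f ?E * prod f ?L"
    using fin by (intro prod.union_disjoint) (auto simp: finite_honeycomb leaf_edge_notin_honeycomb)
  ultimately show ?thesis by (simp add: leafed_honeycomb_def attach_leaves_def)
qed

theorem theorem2p2:
  fixes n :: nat and a s :: real
  assumes "n \<ge> 1"
  shows "(\<Prod>e\<in>edges (PAH n). (\<Sum>v\<in>e. real (deg (PAH n) v)) powr a)
           = 4 powr (6 * a * real n) * 6 powr ((9 * (real n)\<^sup>2 - 3 * real n) * a)
       \<and> (\<Prod>e\<in>edges (PAH n). (\<Prod>v\<in>e. real (deg (PAH n) v)) powr a)
           = 3 powr (18 * a * (real n)\<^sup>2)
       \<and> (\<Prod>u\<in>verts (PAH n). real (deg (PAH n) u) powr s)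
           = 3 powr (6 * s * (real n)\<^sup>2)"
proof -
  let ?H = "honeycomb (int n)" and ?G = "leafed_honeycomb (int n)"
  have n: "int n \<ge> 1" using assms by simp
  note deg_lattice = deg_leafed_honeycomb[OF n]
  have deg_edge: "deg ?G v = 3" if "e \<in> edges ?H" "v \<in> e" for e v
    using that honeycomb_edge_subset deg_lattice by blast
  have deg_leaf_edge: "deg ?G v = 3" "deg ?G (Leaf v) = 1" if "v \<in> boundary (int n)" for v
    using that boundary_subset deg_lattice deg_leafed_honeycomb_Leaf by auto
  \<comment> \<open>This makes the natural-number subtraction in the exponent agree with the real
    one.\<close>
  have "3 * n \<le> 9 * n\<^sup>2"
    using card_edges_honeycomb[OF assms] by linarith
  then have edge_count: "real (9 * n\<^sup>2 - 3 * n) = 9 * (real n)\<^sup>2 - 3 * real n"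
    by (simp add: of_nat_diff)
  \<comment> \<open>Lattice edges give 3 + 3 = 6, pendant edges 3 + 1 = 4.\<close>
  have "(\<Prod>e\<in>edges ?G. (\<Sum>v\<in>e. real (deg ?G v)) powr a) =
      (6 powr a) ^ (9 * n\<^sup>2 - 3 * n) * (4 powr a) ^ (6 * n)"
    by (rule prod_edges_leafed_honeycomb[OF assms])
      (simp_all add: deg_edge deg_leaf_edge honeycomb_edge_card cong: sum.cong)
  also have "\<dots> = 4 powr (6 * a * real n) * 6 powr ((9 * (real n)\<^sup>2 - 3 * real n) * a)"
    by (simp only: powr_power edge_count) (simp add: mult_ac)
  finally have sums: "(\<Prod>e\<in>edges ?G. (\<Sum>v\<in>e. real (deg ?G v)) powr a) =
      4 powr (6 * a * real n) * 6 powr ((9 * (real n)\<^sup>2 - 3 * real n) * a)" .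
  have "(\<Prod>e\<in>edges ?G. (\<Prod>v\<in>e. real (deg ?G v)) powr a) =
      (9 powr a) ^ (9 * n\<^sup>2 - 3 * n) * (3 powr a) ^ (6 * n)"
    by (rule prod_edges_leafed_honeycomb[OF assms])
      (simp_all add: deg_edge deg_leaf_edge honeycomb_edge_card cong: prod.cong)
  \<comment> \<open>With base 3 throughout, the exponents add up to 2(9n^2 - 3n) + 6n = 18n^2, times
    a.\<close>
  also have "(9 :: real) = 3 powr 2" by simp
  also have "((3 powr 2) powr a) ^ (9 * n\<^sup>2 - 3 * n) * (3 powr a) ^ (6 * n) =
      3 powr (18 * a * (real n)\<^sup>2)"
    by (simp only: powr_powr powr_power edge_count powr_add[symmetric])
      (simp add: algebra_simps)
  finally have prods: "(\<Prod>e\<in>edges ?G. (\<Prod>v\<in>e. real (deg ?G v)) powr a) =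
      3 powr (18 * a * (real n)\<^sup>2)" .
  \<comment> \<open>Leaves have degree 1 and contribute the factor 1.\<close>
  have "(\<Prod>u\<in>verts ?G. real (deg ?G u) powr s) = (\<Prod>u\<in>verts ?H. real (deg ?G u) powr s)"
    using boundary_subset[of "int n"] deg_leaf_edge finite_honeycomb
    by (intro prod.mono_neutral_right)
      (auto simp: leafed_honeycomb_def attach_leaves_def finite_subset)
  also have "\<dots> = (3 powr s) ^ (6 * n\<^sup>2)"
    by (simp add: deg_lattice card_verts_honeycomb)
  also have "\<dots> = 3 powr (6 * s * (real n)\<^sup>2)"
    by (simp add: powr_power mult_ac)
  finally show ?thesis
    unfolding PAH_eq[OF assms] using sums prods by blast
qed

end
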